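(* Let $\mathbb{P}=(R,G)$ be a skew partial field and let $C$ be a $\mathbb{P}$-chain group on a finite set $E$. Then $$\mathcal{C}^*:=\{\|c\| : c\in C,\ c \text{ elementary}\}$$ is the set of cocircuits of a matroid on $E$.
   Context: A skew partial field is a pair $\mathbb{P}=(R,G)$ where $R$ is a (not necessarily commutative) ring with identity $1$ and $G$ is a subgroup of the group of units $R^*$ with $-1\in G$. For a ring $R$ and a finite set $E$, an $R$-chain group on $E$ is a subset $C\subseteq R^E$ with $0\in C$ and $f+g\in C$, $rf\in C$ for all $f,g\in C$, $r\in R$ (operations componentwise, scalars multiplying on the left). Elements of $C$ are called chains. The support of a chain $c$ is $\|c\|=\{e\in E: c_e\neq 0\}$. A chain $c\in C$ is elementary if $c\neq 0$ and there is no $c'\in C\setminus\{0\}$ with $\|c'\|\subsetneq\|c\|$. A chain $c$ is $G$-primitive if $c\in (G\cup\{0\})^E$. A $\mathbb{P}$-chain group on $E$ is an $R$-chain group $C$ on $E$ such that every elementary chain $c\in C$ can be written as $c=rc'$ for some $r\in R$ and some $G$-primitive chain $c'\in C$. *)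

theory Defs
  imports "HOL-Algebra.Ring"
begin

definition matroid :: "'e set \<Rightarrow> 'e set set \<Rightarrow> bool" where
  "matroid E \<I> \<longleftrightarrow>
     finite E \<and>
     \<I> \<subseteq> Pow E \<and>
     {} \<in> \<I> \<and>
     (\<forall>X Y. Y \<in> \<I> \<and> X \<subseteq> Y \<longrightarrow> X \<in> \<I>) \<and>
     (\<forall>X Y. X \<in> \<I> \<and> Y \<in> \<I> \<and> card X < card Y \<longrightarrow> (\<exists>y\<in>Y - X. insert y X \<in> \<I>))"

definition bases :: "'e set set \<Rightarrow> 'e set set" where
  "bases \<I> = {B \<in> \<I>. \<forall>X\<in>\<I>. B \<subseteq> X \<longrightarrow> X = B}"

definition circuits :: "'e set \<Rightarrow> 'e set set \<Rightarrow> 'e set set" where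
  "circuits E \<I> = {D. D \<subseteq> E \<and> D \<notin> \<I> \<and> (\<forall>X. X \<subset> D \<longrightarrow> X \<in> \<I>)}"

text \<open>The independent sets of the dual matroid, whose bases are the complements of bases.\<close>

definition dual_indep :: "'e set \<Rightarrow> 'e set set \<Rightarrow> 'e set set" where
  "dual_indep E \<I> = {X. \<exists>B\<in>bases \<I>. X \<subseteq> E - B}"

definition cocircuits :: "'e set \<Rightarrow> 'e set set \<Rightarrow> 'e set set" where
  "cocircuits E \<I> = circuits E (dual_indep E \<I>)"

text \<open>
  Note that \<^term>\<open>ring R\<close> is a ring with identity, not necessarily commutative, and that
  the zero ring is not excluded.
\<close>

definition skew_partial_field :: "('r, 'm) ring_scheme \<Rightarrow> 'r set \<Rightarrow> bool" where
  "skew_partial_field R G \<longleftrightarrow>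
     ring R \<and> subgroup G (units_of R) \<and> \<ominus>\<^bsub>R\<^esub> \<one>\<^bsub>R\<^esub> \<in> G"

text \<open>Vectors in \<open>R\<^sup>E\<close> are extensional functions, i.e. \<^const>\<open>undefined\<close> outside \<open>E\<close>.\<close>

definition zero_chain :: "('r, 'm) ring_scheme \<Rightarrow> 'e set \<Rightarrow> 'e \<Rightarrow> 'r" where
  "zero_chain R E = (\<lambda>e\<in>E. \<zero>\<^bsub>R\<^esub>)"

definition add_chain :: "('r, 'm) ring_scheme \<Rightarrow> 'e set \<Rightarrow> ('e \<Rightarrow> 'r) \<Rightarrow> ('e \<Rightarrow> 'r) \<Rightarrow> 'e \<Rightarrow> 'r" where
  "add_chain R E f g = (\<lambda>e\<in>E. f e \<oplus>\<^bsub>R\<^esub> g e)"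

definition smult_chain :: "('r, 'm) ring_scheme \<Rightarrow> 'e set \<Rightarrow> 'r \<Rightarrow> ('e \<Rightarrow> 'r) \<Rightarrow> 'e \<Rightarrow> 'r" where
  "smult_chain R E r f = (\<lambda>e\<in>E. r \<otimes>\<^bsub>R\<^esub> f e)"

definition chain_group :: "('r, 'm) ring_scheme \<Rightarrow> 'e set \<Rightarrow> ('e \<Rightarrow> 'r) set \<Rightarrow> bool" where
  "chain_group R E C \<longleftrightarrow>
     C \<subseteq> (E \<rightarrow>\<^sub>E carrier R) \<and>
     zero_chain R E \<in> C \<and>
     (\<forall>f\<in>C. \<forall>g\<in>C. add_chain R E f g \<in> C) \<and>
     (\<forall>r\<in>carrier R. \<forall>f\<in>C. smult_chain R E r f \<in> C)"

definition support :: "('r, 'm) ring_scheme \<Rightarrow> 'e set \<Rightarrow> ('e \<Rightarrow> 'r) \<Rightarrow> 'e set" where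
  "support R E c = {e \<in> E. c e \<noteq> \<zero>\<^bsub>R\<^esub>}"

definition elementary ::
    "('r, 'm) ring_scheme \<Rightarrow> 'e set \<Rightarrow> ('e \<Rightarrow> 'r) set \<Rightarrow> ('e \<Rightarrow> 'r) \<Rightarrow> bool" where
  "elementary R E C c \<longleftrightarrow>
     c \<in> C \<and> c \<noteq> zero_chain R E \<and>
     \<not> (\<exists>c'\<in>C - {zero_chain R E}. support R E c' \<subset> support R E c)"

definition primitive :: "('r, 'm) ring_scheme \<Rightarrow> 'r set \<Rightarrow> 'e set \<Rightarrow> ('e \<Rightarrow> 'r) \<Rightarrow> bool" where
  "primitive R G E c \<longleftrightarrow> c \<in> (E \<rightarrow>\<^sub>E G \<union> {\<zero>\<^bsub>R\<^esub>})"

definition skew_chain_group ::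
    "('r, 'm) ring_scheme \<Rightarrow> 'r set \<Rightarrow> 'e set \<Rightarrow> ('e \<Rightarrow> 'r) set \<Rightarrow> bool" where
  "skew_chain_group R G E C \<longleftrightarrow>
     chain_group R E C \<and>
     (\<forall>c. elementary R E C c \<longrightarrow>
        (\<exists>r\<in>carrier R. \<exists>c'\<in>C. primitive R G E c' \<and> c = smult_chain R E r c'))"

end

theory Submission
  imports Defs
begin

text \<open>
  An elementary chain is a left multiple of a primitive chain with the same support, because
  the nonzero entries of the primitive chain are units. Given two elementary chains with distinct
  supports meeting in \<open>e\<close>, normalise the corresponding primitive chains to have entry \<open>1\<close> at \<open>e\<close>;
  their difference vanishes at \<open>e\<close>, but is nonzero where only one of them is. An elementary chain
  inside the support of the difference gives circuit elimination. Hence the supports are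
  the circuits of a matroid, and the cocircuits of its dual.
\<close>

section \<open>Matroids from circuits\<close>

text \<open>These are the independent sets of the matroid whose circuits are to be
  \<open>\<D>\<close>.\<close>

definition sets_avoiding :: "'e set \<Rightarrow> 'e set set \<Rightarrow> 'e set set" where
  "sets_avoiding E \<D> = {X. X \<subseteq> E \<and> (\<forall>D\<in>\<D>. \<not> D \<subseteq> X)}"

text \<open>This is the weak elimination axiom: only \<open>e\<close> is removed, and no element of
  the union is prescribed to lie in \<open>Z\<close>.\<close>

definition circuit_elimination :: "'e set set \<Rightarrow> bool" where
  "circuit_elimination \<D> \<longleftrightarrow>
     (\<forall>X\<in>\<D>. \<forall>Y\<in>\<D>. \<forall>e\<in>X \<inter> Y. X \<noteq> Y \<longrightarrow> (\<exists>Z\<in>\<D>. Z \<subseteq> (X \<union> Y) - {e}))"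

text \<open>Uniqueness of the fundamental circuit. Both members must use \<open>e\<close>, since
  \<open>I\<close> contains no member; eliminating \<open>e\<close> from two distinct ones would
  leave a member inside \<open>I\<close>.\<close>

lemma circuit_in_insert_unique:
  assumes elim: "circuit_elimination \<D>"
    and I: "I \<in> sets_avoiding E \<D>"
    and X: "X \<in> \<D>" "X \<subseteq> insert e I"
    and Y: "Y \<in> \<D>" "Y \<subseteq> insert e I"
  shows "X = Y"
proof (rule ccontr)
  assume "X \<noteq> Y"
  have "e \<in> X" "e \<in> Y"
    using I X Y by (auto simp: sets_avoiding_def)
  then obtain Z where "Z \<in> \<D>" "Z \<subseteq> (X \<union> Y) - {e}"
    using elim X(1) Y(1) \<open>X \<noteq> Y\<close> unfolding circuit_elimination_def by blast
  then show False
    using I X(2) Y(2) unfolding sets_avoiding_def by blast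
qed

text \<open>If augmentation fails, take an avoiding set \<open>Z\<close> inside
  \<open>X \<union> Y\<close>, larger than \<open>X\<close>, that misses as few elements of
  \<open>X\<close> as possible. Swapping some \<open>e\<close> of \<open>X - Z\<close> into
  \<open>Z\<close> must then create a circuit, whichever element of \<open>Z - X\<close> is given up
  for it. All these circuits coincide by uniqueness, which is contradictory.\<close>

lemma sets_avoiding_augment:
  assumes fin: "finite E"
    and elim: "circuit_elimination \<D>"
    and X: "X \<in> sets_avoiding E \<D>" and Y: "Y \<in> sets_avoiding E \<D>"
    and less: "card X < card Y"
  shows "\<exists>y\<in>Y - X. insert y X \<in> sets_avoiding E \<D>"
proof (rule ccontr)
  assume stuck: "\<not> ?thesis"
  let ?P = "\<lambda>Z. Z \<in> sets_avoiding E \<D> \<and> Z \<subseteq> X \<union> Y \<and> card X < card Z"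
  have "?P Y"
    using Y less by simp
  then obtain Z where Z: "?P Z" and min: "\<And>W. ?P W \<Longrightarrow> card (X - Z) \<le> card (X - W)"
    using ex_has_least_nat[of ?P Y "\<lambda>W. card (X - W)"] by blast
  have finX: "finite X" and finZ: "finite Z"
    using X Z fin by (auto simp: sets_avoiding_def intro: finite_subset)
  have "\<not> Z \<subseteq> X"
    using Z card_mono[OF finX, of Z] by auto
  \<comment> \<open>Otherwise any \<open>z\<close> in \<open>Z - X\<close> comes from
    \<open>Y\<close>, and \<open>insert z X\<close> lies inside the avoiding set \<open>Z\<close>,
    so \<open>X\<close> could be augmented after all.\<close>
  have "\<not> X \<subseteq> Z"
  proof
    assume "X \<subseteq> Z"
    obtain z where z: "z \<in> Z" "z \<notin> X"
      using \<open>\<not> Z \<subseteq> X\<close> by blast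
    have "insert z X \<in> sets_avoiding E \<D>"
      using Z z \<open>X \<subseteq> Z\<close> unfolding sets_avoiding_def by blast
    then show False
      using stuck Z z by blast
  qed
  then obtain e where e: "e \<in> X" "e \<notin> Z"
    by blast
  \<comment> \<open>The swapped set is as large as \<open>Z\<close> but misses one element of
    \<open>X\<close> fewer, so by the choice of \<open>Z\<close> it cannot be avoiding.\<close>
  have exchange: "\<exists>D\<in>\<D>. D \<subseteq> insert e Z - {f}" if f: "f \<in> Z - X" for f
  proof (rule ccontr)
    assume none: "\<not> ?thesis"
    let ?W = "insert e Z - {f}"
    have "?W \<in> sets_avoiding E \<D>"
      using none X Z e unfolding sets_avoiding_def by blast
    moreover have "card ?W = card Z"
    proof -
      have "?W = insert e (Z - {f})"
        using e f by auto
      then show ?thesis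
        using e f finZ card_Suc_Diff1[OF finZ, of f] by simp
    qed
    ultimately have "?P ?W"
      using Z e by auto
    moreover have "X - ?W \<subset> X - Z"
      using e f by auto
    then have "card (X - ?W) < card (X - Z)"
      using finX by (intro psubset_card_mono) auto
    ultimately show False
      using min by fastforce
  qed
  obtain f where f: "f \<in> Z - X"
    using \<open>\<not> Z \<subseteq> X\<close> by blast
  obtain D where D: "D \<in> \<D>" "D \<subseteq> insert e Z - {f}"
    using exchange[OF f] by blast
  have "\<not> D \<subseteq> X"
    using X D(1) by (auto simp: sets_avoiding_def)
  then obtain g where g: "g \<in> D" "g \<in> Z - X"
    using D(2) e by blast
  \<comment> \<open>The second exchange gives up an element \<open>g\<close> of the first circuit.
    Both circuits lie in \<open>insert e Z\<close>, hence are equal, although only one of them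
    contains \<open>g\<close>.\<close>
  obtain D' where D': "D' \<in> \<D>" "D' \<subseteq> insert e Z - {g}"
    using exchange[OF g(2)] by blast
  have "D = D'"
    using circuit_in_insert_unique[OF elim, of Z E D e D'] Z D D' by blast
  then show False
    using g(1) D'(2) by blast
qed

lemma matroid_sets_avoiding:
  assumes "finite E" "{} \<notin> \<D>" "circuit_elimination \<D>"
  shows "matroid E (sets_avoiding E \<D>)"
  unfolding matroid_def
proof (intro conjI allI impI)
  show "\<exists>y\<in>Y - X. insert y X \<in> sets_avoiding E \<D>"
    if "X \<in> sets_avoiding E \<D> \<and> Y \<in> sets_avoiding E \<D> \<and> card X < card Y" for X Y
    using that assms sets_avoiding_augment by blast
  show "X \<in> sets_avoiding E \<D>" if "Y \<in> sets_avoiding E \<D> \<and> X \<subseteq> Y" for X Y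
    using that unfolding sets_avoiding_def by blast
  show "{} \<in> sets_avoiding E \<D>"
    using assms(2) by (auto simp: sets_avoiding_def)
qed (use assms(1) in \<open>auto simp: sets_avoiding_def\<close>)

text \<open>A dependent subset of \<open>E\<close> contains a member of \<open>\<D>\<close>, so a
  minimal one is that member. Conversely, incomparability keeps the proper subsets of a member free
  of members.\<close>

lemma circuits_sets_avoiding:
  assumes "\<D> \<subseteq> Pow E"
    and clutter: "\<And>X Y. X \<in> \<D> \<Longrightarrow> Y \<in> \<D> \<Longrightarrow> \<not> X \<subset> Y"
  shows "circuits E (sets_avoiding E \<D>) = \<D>"
proof
  show "circuits E (sets_avoiding E \<D>) \<subseteq> \<D>"
  proof
    fix D assume D: "D \<in> circuits E (sets_avoiding E \<D>)"
    then obtain D' where "D' \<in> \<D>" "D' \<subseteq> D"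
      by (auto simp: circuits_def sets_avoiding_def)
    moreover have "D' \<notin> sets_avoiding E \<D>"
      using \<open>D' \<in> \<D>\<close> by (auto simp: sets_avoiding_def)
    ultimately show "D \<in> \<D>"
      using D by (auto simp: circuits_def)
  qed
  show "\<D> \<subseteq> circuits E (sets_avoiding E \<D>)"
    using assms unfolding circuits_def sets_avoiding_def by blast
qed

section \<open>Duality\<close>

lemma bases_indep: "B \<in> bases \<I> \<Longrightarrow> B \<in> \<I>"
  by (simp add: bases_def)

lemma matroid_indep_finite: "matroid E \<I> \<Longrightarrow> X \<in> \<I> \<Longrightarrow> finite X"
  unfolding matroid_def by (meson PowD finite_subset subsetD)

text \<open>Augmentation is iterated with elements of \<open>Y\<close> only. The bound
  \<open>Z \<subseteq> X \<union> Y\<close> later keeps an extended base away from a given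
  set.\<close>

lemma matroid_augment_to_card:
  assumes M: "matroid E \<I>" and X: "X \<in> \<I>" and Y: "Y \<in> \<I>" and "card X \<le> card Y"
  shows "\<exists>Z\<in>\<I>. X \<subseteq> Z \<and> Z \<subseteq> X \<union> Y \<and> card Z = card Y"
  using X \<open>card X \<le> card Y\<close>
proof (induction "card Y - card X" arbitrary: X)
  case 0
  then show ?case by (intro bexI[of _ X]) auto
next
  case (Suc n)
  then have "card X < card Y" by simp
  then obtain y where y: "y \<in> Y - X" "insert y X \<in> \<I>"
    using M Suc.prems Y unfolding matroid_def by blast
  have "card (insert y X) = Suc (card X)"
    using y matroid_indep_finite[OF M Suc.prems(1)] by simp
  then have "n = card Y - card (insert y X)" "card (insert y X) \<le> card Y"
    using Suc.hyps(2) by auto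
  then obtain Z where "Z \<in> \<I>" "insert y X \<subseteq> Z" "Z \<subseteq> insert y X \<union> Y" "card Z = card Y"
    using Suc.hyps(1)[OF _ y(2)] by blast
  then show ?case
    using y by (intro bexI[of _ Z]) auto
qed

lemma card_indep_le_base:
  assumes M: "matroid E \<I>" and X: "X \<in> \<I>" and B: "B \<in> bases \<I>"
  shows "card X \<le> card B"
proof (rule ccontr)
  assume "\<not> ?thesis"
  then obtain y where "y \<in> X - B" "insert y B \<in> \<I>"
    using M X bases_indep[OF B] unfolding matroid_def by (meson not_le)
  then show False
    using B by (auto simp: bases_def)
qed

lemma base_if_card_eq:
  assumes M: "matroid E \<I>" and X: "X \<in> \<I>" and B: "B \<in> bases \<I>" and eq: "card X = card B"
  shows "X \<in> bases \<I>"
proof -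
  have "Y = X" if "Y \<in> \<I>" "X \<subseteq> Y" for Y
    using that card_seteq[of Y X] card_indep_le_base[OF M that(1) B] eq
      matroid_indep_finite[OF M that(1)] by simp
  then show ?thesis
    using X by (auto simp: bases_def)
qed

lemma indep_subset_base:
  assumes M: "matroid E \<I>" and X: "X \<in> \<I>"
  shows "\<exists>B\<in>bases \<I>. X \<subseteq> B"
proof -
  have fin: "finite \<I>"
    using M unfolding matroid_def by (meson finite_Pow_iff finite_subset)
  obtain B where "B \<in> \<I>" "X \<subseteq> B" "\<And>Y. Y \<in> \<I> \<Longrightarrow> B \<subseteq> Y \<Longrightarrow> B = Y"
    using finite_has_maximal2[OF fin X] by auto
  then show ?thesis
    unfolding bases_def by blast
qed

text \<open>A base \<open>B\<close> avoiding \<open>X\<close> is built to contain as much of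
  \<open>B2\<close> as possible, namely \<open>B2 - X\<close>. An element of \<open>Y - X\<close>
  outside \<open>B\<close> could be added to \<open>X\<close>; if there is none, \<open>B\<close>
  contains both \<open>B2 - X\<close> and \<open>Y - X\<close> and becomes larger than
  \<open>B2\<close>.\<close>

lemma dual_indep_augment:
  assumes M: "matroid E \<I>"
    and X: "X \<in> dual_indep E \<I>" and Y: "Y \<in> dual_indep E \<I>"
    and less: "card X < card Y"
  shows "\<exists>y\<in>Y - X. insert y X \<in> dual_indep E \<I>"
proof (rule ccontr)
  assume stuck: "\<not> ?thesis"
  obtain B1 where B1: "B1 \<in> bases \<I>" "X \<subseteq> E - B1"
    using X by (auto simp: dual_indep_def)
  obtain B2 where B2: "B2 \<in> bases \<I>" "Y \<subseteq> E - B2"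
    using Y by (auto simp: dual_indep_def)
  have finE: "finite E" and B2E: "B2 \<subseteq> E"
    using M bases_indep[OF B2(1)] by (auto simp: matroid_def)
  have fin: "finite X" "finite Y" "finite B2"
    using finE B1(2) B2(2) B2E by (auto intro: finite_subset)
  have indep: "B2 - X \<in> \<I>"
    using M bases_indep[OF B2(1)] unfolding matroid_def by (meson Diff_subset)
  \<comment> \<open>The new elements come from \<open>B1\<close>, which is disjoint from
    \<open>X\<close>; hence so is \<open>B\<close>.\<close>
  obtain B where B: "B \<in> \<I>" "B2 - X \<subseteq> B" "B \<subseteq> (B2 - X) \<union> B1" "card B = card B1"
    using matroid_augment_to_card[OF M indep bases_indep[OF B1(1)]]
      card_indep_le_base[OF M indep B1(1)] by blast
  have base: "B \<in> bases \<I>"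
    using base_if_card_eq[OF M B(1) B1(1) B(4)] .
  have "Y - X \<subseteq> B"
  proof
    fix y assume y: "y \<in> Y - X"
    show "y \<in> B"
    proof (rule ccontr)
      assume "y \<notin> B"
      then have "insert y X \<subseteq> E - B"
        using y B1(2) B2(2) B(3) by blast
      then show False
        using base stuck y by (auto simp: dual_indep_def)
    qed
  qed
  then have "(B2 - X) \<union> (Y - X) \<subseteq> B"
    using B(2) by blast
  moreover have "(B2 - X) \<inter> (Y - X) = {}"
    using B2(2) by blast
  ultimately have "card (B2 - X) + card (Y - X) \<le> card B"
    using fin card_mono[OF matroid_indep_finite[OF M B(1)]]
    by (metis card_Un_disjoint finite_Diff)
  moreover have "card B \<le> card B2"
    using card_indep_le_base[OF M B(1) B2(1)] .
  moreover have "card B2 = card (B2 - X) + card (B2 \<inter> X)"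
    using fin by (metis add.commute card_Int_Diff)
  \<comment> \<open>Since \<open>B2\<close> misses \<open>Y\<close>, what it loses to
    \<open>X\<close> lies in \<open>X - Y\<close>, which is smaller than the gain
    \<open>Y - X\<close>.\<close>
  moreover have "card (B2 \<inter> X) \<le> card (X - Y)"
    using fin B2(2) by (intro card_mono) auto
  moreover have "card (X - Y) < card (Y - X)"
    using less fin card_Int_Diff[of X Y] card_Int_Diff[of Y X] by (simp add: Int_commute)
  ultimately show False
    by linarith
qed

lemma matroid_dual:
  assumes M: "matroid E \<I>"
  shows "matroid E (dual_indep E \<I>)"
  unfolding matroid_def
proof (intro conjI allI impI)
  show "finite E"
    using M by (simp add: matroid_def)
  show "{} \<in> dual_indep E \<I>"
    using indep_subset_base[OF M, of "{}"] M by (auto simp: matroid_def dual_indep_def)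
  show "\<exists>y\<in>Y - X. insert y X \<in> dual_indep E \<I>"
    if "X \<in> dual_indep E \<I> \<and> Y \<in> dual_indep E \<I> \<and> card X < card Y" for X Y
    using that dual_indep_augment[OF M] by blast
qed (auto simp: dual_indep_def)

text \<open>Complementation reverses inclusion, and distinct bases are incomparable, so each
  complement of a base is already maximal.\<close>

lemma bases_dual_indep:
  assumes "\<I> \<subseteq> Pow E"
  shows "bases (dual_indep E \<I>) = (\<lambda>B. E - B) ` bases \<I>"
proof
  show "bases (dual_indep E \<I>) \<subseteq> (\<lambda>B. E - B) ` bases \<I>"
    unfolding bases_def dual_indep_def by blast
  show "(\<lambda>B. E - B) ` bases \<I> \<subseteq> bases (dual_indep E \<I>)"
  proof
    fix X assume "X \<in> (\<lambda>B. E - B) ` bases \<I>"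
    then obtain B where B: "B \<in> bases \<I>" "X = E - B"
      by blast
    have "Y = X" if Y: "B' \<in> bases \<I>" "Y \<subseteq> E - B'" "X \<subseteq> Y" for Y B'
    proof -
      have "B' \<subseteq> B"
        using Y B(2) assms bases_indep[OF Y(1)] by blast
      then have "B' = B"
        using Y(1) bases_indep[OF B(1)] by (auto simp: bases_def)
      then show ?thesis
        using Y B(2) by blast
    qed
    moreover have "X \<in> dual_indep E \<I>"
      using B by (auto simp: dual_indep_def)
    ultimately show "X \<in> bases (dual_indep E \<I>)"
      unfolding bases_def[of "dual_indep E \<I>"] by (auto simp: dual_indep_def)
  qed
qed

text \<open>Complementing twice restores the bases, and the independent sets are exactly the subsets
  of bases.\<close>

lemma dual_dual_indep:
  assumes M: "matroid E \<I>"
  shows "dual_indep E (dual_indep E \<I>) = \<I>"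
proof -
  have sub: "\<I> \<subseteq> Pow E"
    using M by (simp add: matroid_def)
  have "E - (E - B) = B" if "B \<in> bases \<I>" for B
    using sub bases_indep[OF that] by blast
  then have "dual_indep E (dual_indep E \<I>) = {X. \<exists>B\<in>bases \<I>. X \<subseteq> B}"
    by (auto simp: dual_indep_def[of E "dual_indep E \<I>"] bases_dual_indep[OF sub])
  also have "\<dots> = \<I>"
  proof
    show "{X. \<exists>B\<in>bases \<I>. X \<subseteq> B} \<subseteq> \<I>"
      using M bases_indep[of _ \<I>] unfolding matroid_def by (smt (verit) mem_Collect_eq subsetI)
    show "\<I> \<subseteq> {X. \<exists>B\<in>bases \<I>. X \<subseteq> B}"
      using indep_subset_base[OF M] by blast
  qed
  finally show ?thesis .
qed

section \<open>Chain groups\<close>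

text \<open>Chains are extensional, so vanishing on \<open>E\<close> determines them as
  functions.\<close>

lemma support_eq_empty_iff:
  assumes "chain_group R E C" "c \<in> C"
  shows "support R E c = {} \<longleftrightarrow> c = zero_chain R E"
proof
  assume "support R E c = {}"
  moreover have "c \<in> extensional E"
    using assms unfolding chain_group_def PiE_def by blast
  ultimately show "c = zero_chain R E"
    by (intro extensionalityI[of _ E]) (auto simp: support_def zero_chain_def)
qed (auto simp: support_def zero_chain_def)

text \<open>A finite \<open>E\<close> has only finitely many supports, so a minimal support of a
  nonzero chain exists below that of \<open>c\<close>.\<close>

lemma exists_elementary_support_subset:
  assumes "finite E" "c \<in> C" "c \<noteq> zero_chain R E"
  shows "\<exists>d. elementary R E C d \<and> support R E d \<subseteq> support R E c"
proof -
  let ?S = "support R E ` (C - {zero_chain R E})"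
  have "?S \<subseteq> Pow E"
    by (auto simp: support_def)
  then have "finite ?S"
    using \<open>finite E\<close> by (meson finite_Pow_iff finite_subset)
  moreover have "support R E c \<in> ?S"
    using assms by blast
  ultimately obtain S where S: "S \<in> ?S" "S \<subseteq> support R E c" "\<And>T. T \<in> ?S \<Longrightarrow> T \<subseteq> S \<Longrightarrow> S = T"
    using finite_has_minimal2[of ?S "support R E c"] by metis
  then obtain d where d: "d \<in> C" "d \<noteq> zero_chain R E" "S = support R E d"
    by blast
  have "\<not> support R E d' \<subset> S" if "d' \<in> C - {zero_chain R E}" for d'
    using S(3)[of "support R E d'"] that by blast
  then show ?thesis
    using d S(2) by (auto simp: elementary_def)
qed

context ring
begin

text \<open>The ring may have zero divisors and need not commute, so cancellation multiplies by the
  inverse of the unit, on the matching side.\<close>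

lemma unit_mult_eq_zero_iff:
  assumes "u \<in> Units R" "r \<in> carrier R"
  shows "r \<otimes> u = \<zero> \<longleftrightarrow> r = \<zero>" and "u \<otimes> r = \<zero> \<longleftrightarrow> r = \<zero>"
proof -
  have u: "u \<in> carrier R" "inv u \<in> carrier R" "u \<otimes> inv u = \<one>" "inv u \<otimes> u = \<one>"
    using assms by auto
  have "r = (r \<otimes> u) \<otimes> inv u" "r = inv u \<otimes> (u \<otimes> r)"
    using u assms(2) by (simp_all add: m_assoc) (simp add: m_assoc[symmetric])
  then show "r \<otimes> u = \<zero> \<longleftrightarrow> r = \<zero>" "u \<otimes> r = \<zero> \<longleftrightarrow> r = \<zero>"
    using u by (metis l_null, metis r_null)
qed

text \<open>The scalar \<open>r\<close> may be a zero divisor; it still annihilates no nonzero entry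
  of \<open>c\<close>, because such an entry is a unit.\<close>

lemma support_smult_primitive:
  assumes "G \<subseteq> Units R" "primitive R G E c" "r \<in> carrier R" "r \<noteq> \<zero>"
  shows "support R E (smult_chain R E r c) = support R E c"
proof -
  have "r \<otimes> c e = \<zero> \<longleftrightarrow> c e = \<zero>" if "e \<in> E" for e
  proof (cases "c e = \<zero>")
    case False
    then have "c e \<in> Units R"
      using assms(1,2) PiE_mem[OF _ that] by (fastforce simp: primitive_def)
    then show ?thesis
      using False assms(3,4) unit_mult_eq_zero_iff(1) by simp
  qed (simp add: assms(3))
  then show ?thesis
    by (auto simp: support_def smult_chain_def)
qed

lemma elementary_support_primitive:
  assumes "G \<subseteq> Units R" "skew_chain_group R G E C" "elementary R E C c"
  shows "\<exists>d\<in>C. primitive R G E d \<and> support R E d = support R E c"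
proof -
  obtain r d where d: "r \<in> carrier R" "d \<in> C" "primitive R G E d" "c = smult_chain R E r d"
    using assms unfolding skew_chain_group_def by blast
  have cg: "chain_group R E C"
    using assms(2) by (simp add: skew_chain_group_def)
  have "r \<noteq> \<zero>"
  proof
    assume "r = \<zero>"
    moreover have "d \<in> E \<rightarrow>\<^sub>E carrier R"
      using cg d(2) by (auto simp: chain_group_def)
    ultimately have "c = zero_chain R E"
      using d(4) unfolding smult_chain_def zero_chain_def by (auto intro!: restrict_ext l_null)
    then show False
      using assms(3) by (simp add: elementary_def)
  qed
  then show ?thesis
    using d support_smult_primitive[OF assms(1)] by blast
qed

lemma elementary_supports_elimination:
  assumes G: "G \<subseteq> Units R" and fin: "finite E" and C: "skew_chain_group R G E C"
    and c: "elementary R E C c" and d: "elementary R E C d"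
    and ne: "support R E c \<noteq> support R E d"
    and e: "e \<in> support R E c" "e \<in> support R E d"
  shows "\<exists>b. elementary R E C b \<and> support R E b \<subseteq> support R E c \<union> support R E d - {e}"
proof -
  have cg: "chain_group R E C"
    using C by (simp add: skew_chain_group_def)
  obtain p where p: "p \<in> C" "primitive R G E p" "support R E p = support R E c"
    using elementary_support_primitive[OF G C c] by blast
  obtain q where q: "q \<in> C" "primitive R G E q" "support R E q = support R E d"
    using elementary_support_primitive[OF G C d] by blast
  have eE: "e \<in> E" and units: "p e \<in> Units R" "q e \<in> Units R"
    using e p q G by (auto simp: support_def primitive_def PiE_def Pi_def)
  have cl: "p x \<in> carrier R" "q x \<in> carrier R" if "x \<in> E" for x
    using p(1) q(1) cg that by (auto simp: chain_group_def PiE_def Pi_def)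
  \<comment> \<open>The left scalars turn the entries at \<open>e\<close> into \<open>\<one>\<close>
    and \<open>\<ominus> \<one>\<close>. The sign sits in the scalar because chain groups are closed
    under sums and left multiples.\<close>
  define b where "b = add_chain R E (smult_chain R E (inv (p e)) p) (smult_chain R E (\<ominus> (inv (q e))) q)"
  have b_val: "b x = inv (p e) \<otimes> p x \<oplus> (\<ominus> (inv (q e))) \<otimes> q x" if "x \<in> E" for x
    using that by (simp add: b_def add_chain_def smult_chain_def)
  have bC: "b \<in> C"
    using cg p(1) q(1) units by (auto simp: b_def chain_group_def)
  have "b e = \<zero>"
    using units cl[OF eE] by (simp add: b_val eE l_minus r_neg)
  moreover have "b x = \<zero>" if "x \<in> E" "p x = \<zero>" "q x = \<zero>" for x
    using that units by (simp add: b_val)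
  ultimately have sub: "support R E b \<subseteq> support R E c \<union> support R E d - {e}"
    unfolding p(3)[symmetric] q(3)[symmetric] by (auto simp: support_def)
  \<comment> \<open>Minimality of \<open>d\<close> yields a position \<open>f\<close> where
    \<open>p\<close> is nonzero and \<open>q\<close> vanishes. There \<open>b\<close> is a unit
    times \<open>p f\<close>, hence nonzero.\<close>
  have "\<not> support R E c \<subset> support R E d"
    using c d by (auto simp: elementary_def)
  then have "\<not> support R E p \<subseteq> support R E q"
    using ne unfolding p(3) q(3) by blast
  then obtain f where f: "f \<in> support R E p" "f \<notin> support R E q"
    by blast
  then have fE: "f \<in> E" and "p f \<noteq> \<zero>" "q f = \<zero>"
    by (auto simp: support_def)
  then have "b f \<noteq> \<zero>"
    using units cl[OF fE] unit_mult_eq_zero_iff(2)[of "inv (p e)" "p f"] by (simp add: b_val)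
  then have "b \<noteq> zero_chain R E"
    using fE by (auto simp: zero_chain_def)
  then show ?thesis
    using exists_elementary_support_subset[OF fin bC] sub by blast
qed

end

theorem theorem3p7:
  fixes R :: "('r, 'm) ring_scheme" and G :: "'r set"
    and E :: "'e set" and C :: "('e \<Rightarrow> 'r) set"
  assumes "skew_partial_field R G"
    and "finite E"
    and "skew_chain_group R G E C"
  shows "\<exists>\<I>. matroid E \<I> \<and> cocircuits E \<I> = {support R E c | c. c \<in> C \<and> elementary R E C c}"
proof -
  let ?D = "{support R E c | c. c \<in> C \<and> elementary R E C c}"
  interpret ring R
    using assms(1) by (simp add: skew_partial_field_def)
  have G: "G \<subseteq> Units R"
    using assms(1) subgroup.subset by (fastforce simp: skew_partial_field_def units_of_carrier)
  have cg: "chain_group R E C"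
    using assms(3) by (simp add: skew_chain_group_def)
  have D_iff: "X \<in> ?D \<longleftrightarrow> (\<exists>c. elementary R E C c \<and> X = support R E c)" for X
    by (auto simp: elementary_def)
  have sub: "?D \<subseteq> Pow E"
    by (auto simp: support_def)
  have nonempty: "{} \<notin> ?D"
    using support_eq_empty_iff[OF cg] unfolding elementary_def by blast
  have clutter: "\<not> X \<subset> Y" if "X \<in> ?D" "Y \<in> ?D" for X Y
    using that unfolding elementary_def by blast
  have elim: "circuit_elimination ?D"
    unfolding circuit_elimination_def
  proof (intro ballI impI)
    fix X Y e assume "X \<in> ?D" "Y \<in> ?D" "e \<in> X \<inter> Y" "X \<noteq> Y"
    then obtain c d where "elementary R E C c" "X = support R E c"
      "elementary R E C d" "Y = support R E d"
      unfolding D_iff by blast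
    then obtain b where "elementary R E C b" "support R E b \<subseteq> X \<union> Y - {e}"
      using elementary_supports_elimination[OF G assms(2,3)] \<open>e \<in> X \<inter> Y\<close> \<open>X \<noteq> Y\<close> by blast
    then show "\<exists>Z\<in>?D. Z \<subseteq> X \<union> Y - {e}"
      unfolding Bex_def D_iff by blast
  qed
  have M: "matroid E (sets_avoiding E ?D)"
    using matroid_sets_avoiding[OF assms(2) nonempty elim] .
  show ?thesis
  proof (intro exI conjI)
    \<comment> \<open>The witness is the dual of the matroid with circuits \<open>?D\<close>: its
      cocircuits are the circuits of the double dual, which is the original matroid.\<close>
    show "matroid E (dual_indep E (sets_avoiding E ?D))"
      using matroid_dual[OF M] .
    show "cocircuits E (dual_indep E (sets_avoiding E ?D)) = ?D"
      unfolding cocircuits_def dual_dual_indep[OF M]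
      using circuits_sets_avoiding[OF sub clutter] .
  qed
qed

end
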